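(* Let $d\ge2$ and let $\Omega$ be any bounded Lipschitz domain in $\mathbb{R}^d$ with $\mathbb{R}^d\setminus\overline\Omega$ connected. Suppose that $$A(x)=U\begin{pmatrix}1&0\\0&A_{d-1}(x)\end{pmatrix}U^T,\qquad x\in\overline\Omega,$$ with some symmetric positive definite $(d-1)\times(d-1)$ matrix $A_{d-1}(x)$ and a constant orthogonal matrix $U$, and let $q=1$ in $\Omega$. Then any $k>0$ is a non-scattering frequency for $(A,1;\Omega)$.
   Context: Standing assumptions: $A\in \mathrm{L}^\infty(\Omega,\mathbb{R}^{d\times d})$, $A\not\equiv\mathrm{Id}$ in $\overline\Omega$, $\operatorname*{ess\,inf}_{x\in\Omega}\inf_{\xi\in\mathbb{C}^d,|\xi|=1}(\xi\cdot A(x)\overline\xi)>0$, and $A=\mathrm{Id}$, $q=1$ in $\mathbb{R}^d\setminus\overline\Omega$. $k>0$ is a non-scattering frequency for $(A,q;\Omega)$ if there are a domain $\tilde\Omega$ with $\overline\Omega\subset\tilde\Omega$, a non-zero function $u_i$ solving $\Delta u_i+k^2u_i=0$ in $\tilde\Omega$, and a solution $u_s$ (the scattered field, in $\mathrm{H}^1$ of every bounded domain) of the weakly understood problem $$\mathrm{div}(A\nabla u_s)+k^2qu_s=-\mathrm{div}((A-\mathrm{Id})\nabla u_i)-k^2(q-1)u_i\ \text{ in }\mathbb{R}^d,\qquad \lim_{R\to+\infty}\int_{|x|=R}\Big|\frac{\partial u_s}{\partial r}-iku_s\Big|^2ds=0$$ ($u_i$ extended by zero outside $\tilde\Omega$)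 such that $u_s=0$ in $\mathbb{R}^d\setminus\Omega$. *)

theory Defs
  imports "HOL-Analysis.Analysis"
begin

section \<open>Domains\<close>

definition domain :: "(real^'n::finite) set \<Rightarrow> bool" where
  "domain D \<longleftrightarrow> D \<noteq> {} \<and> open D \<and> connected D"

text \<open>Near every boundary point, the domain is the strict epigraph of a Lipschitz function over
  a hyperplane; the hyperplane is given by its unit normal \<open>\<nu>\<close> in place of a rigid change of
  coordinates.\<close>

definition bounded_lipschitz_domain :: "(real^'n::finite) set \<Rightarrow> bool" where
  "bounded_lipschitz_domain D \<longleftrightarrow> domain D \<and> bounded D \<and>
     (\<forall>p\<in>frontier D. \<exists>\<nu> r L \<gamma>. norm \<nu> = 1 \<and> 0 < r \<and> L-lipschitz_on {y. y \<bullet> \<nu> = 0} \<gamma> \<and>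
        D \<inter> ball p r = {x \<in> ball p r. \<gamma> (x - (x \<bullet> \<nu>) *\<^sub>R \<nu>) < x \<bullet> \<nu>})"


section \<open>Complex vectors and real matrices acting on them\<close>

text \<open>The dot product of complex vectors is bilinear (no conjugation).\<close>

definition cdot :: "complex^'n::finite \<Rightarrow> complex^'n \<Rightarrow> complex" where
  "cdot \<xi> \<eta> = (\<Sum>i\<in>UNIV. \<xi> $ i * \<eta> $ i)"

definition vec_cnj :: "complex^'n::finite \<Rightarrow> complex^'n" where
  "vec_cnj \<xi> = (\<chi> i. cnj (\<xi> $ i))"

definition cmatrix :: "real^'n^'m \<Rightarrow> complex^'n::finite^'m::finite" where
  "cmatrix M = (\<chi> i j. complex_of_real (M $ i $ j))"


section \<open>Assumptions on the coefficients\<close>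

definition ess_inf :: "'a measure \<Rightarrow> ('a \<Rightarrow> real) \<Rightarrow> ereal" where
  "ess_inf M f = Sup {c. AE x in M. c \<le> ereal (f x)}"

definition L_infinity :: "(real^'n::finite) set \<Rightarrow> (real^'n \<Rightarrow> 'b::real_normed_vector) \<Rightarrow> bool" where
  "L_infinity D f \<longleftrightarrow> f \<in> borel_measurable (lebesgue_on D) \<and>
     (\<exists>C. AE x in lebesgue_on D. norm (f x) \<le> C)"

text \<open>For a symmetric real matrix the form \<open>\<xi> \<cdot> M \<xi>\<^sup>*\<close> is real, and \<open>Re\<close> only adjusts its type.\<close>

definition coefficient_assumptions ::
  "(real^'n::finite \<Rightarrow> real^'n^'n) \<Rightarrow> (real^'n \<Rightarrow> real) \<Rightarrow> (real^'n) set \<Rightarrow> bool" where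
  "coefficient_assumptions A q \<Omega> \<longleftrightarrow>
     L_infinity \<Omega> A \<and>
     \<not> (AE x in lebesgue_on (closure \<Omega>). A x = mat 1) \<and>
     0 < ess_inf (lebesgue_on \<Omega>)
           (\<lambda>x. INF \<xi>\<in>{\<xi>. norm \<xi> = 1}. Re (cdot \<xi> (cmatrix (A x) *v vec_cnj \<xi>))) \<and>
     (\<forall>x. x \<notin> closure \<Omega> \<longrightarrow> A x = mat 1 \<and> q x = 1)"


section \<open>Differentiation and test functions\<close>

definition partial :: "'n \<Rightarrow> (real^'n::finite \<Rightarrow> complex) \<Rightarrow> real^'n \<Rightarrow> complex" where
  "partial i f x = frechet_derivative f (at x) (axis i 1)"

definition grad :: "(real^'n::finite \<Rightarrow> complex) \<Rightarrow> real^'n \<Rightarrow> complex^'n" where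
  "grad f x = (\<chi> i. partial i f x)"

primrec Ck_on :: "nat \<Rightarrow> (real^'n::finite) set \<Rightarrow> (real^'n \<Rightarrow> complex) \<Rightarrow> bool" where
  "Ck_on 0 D f \<longleftrightarrow> continuous_on D f"
| "Ck_on (Suc k) D f \<longleftrightarrow> (\<forall>x\<in>D. f differentiable at x) \<and> (\<forall>i. Ck_on k D (partial i f))"

definition test_function :: "(real^'n::finite) set \<Rightarrow> (real^'n \<Rightarrow> complex) \<Rightarrow> bool" where
  "test_function D \<phi> \<longleftrightarrow> (\<forall>k. Ck_on k UNIV \<phi>) \<and>
     compact (closure {x. \<phi> x \<noteq> 0}) \<and> closure {x. \<phi> x \<noteq> 0} \<subseteq> D"

definition helmholtz_solution ::
  "real \<Rightarrow> (real^'n::finite) set \<Rightarrow> (real^'n \<Rightarrow> complex) \<Rightarrow> bool" where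
  "helmholtz_solution k D u \<longleftrightarrow> Ck_on 2 D u \<and>
     (\<forall>x\<in>D. (\<Sum>i\<in>UNIV. partial i (partial i u) x) + (complex_of_real k)\<^sup>2 * u x = 0)"


section \<open>Weak derivatives and \<open>H\<^sup>1\<close>\<close>

definition locally_integrable ::
  "(real^'n::finite) set \<Rightarrow> (real^'n \<Rightarrow> 'b::{banach, second_countable_topology}) \<Rightarrow> bool" where
  "locally_integrable D f \<longleftrightarrow> (\<forall>K. compact K \<and> K \<subseteq> D \<longrightarrow> integrable (lebesgue_on K) f)"

definition weak_gradient ::
  "(real^'n::finite) set \<Rightarrow> (real^'n \<Rightarrow> complex) \<Rightarrow> (real^'n \<Rightarrow> complex^'n) \<Rightarrow> bool" where
  "weak_gradient D u g \<longleftrightarrow> locally_integrable D u \<and> locally_integrable D g \<and>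
     (\<forall>\<phi> i. test_function D \<phi> \<longrightarrow>
        (LINT x|lebesgue_on D. u x * partial i \<phi> x) = - (LINT x|lebesgue_on D. g x $ i * \<phi> x))"

definition L2 ::
  "(real^'n::finite) set \<Rightarrow> (real^'n \<Rightarrow> 'b::{banach, second_countable_topology}) \<Rightarrow> bool" where
  "L2 D f \<longleftrightarrow> f \<in> borel_measurable (lebesgue_on D) \<and>
     integrable (lebesgue_on D) (\<lambda>x. (norm (f x))\<^sup>2)"

definition H1 :: "(real^'n::finite) set \<Rightarrow> (real^'n \<Rightarrow> complex) \<Rightarrow> bool" where
  "H1 D u \<longleftrightarrow> L2 D u \<and> (\<exists>g. weak_gradient D u g \<and> L2 D g)"

text \<open>The distribution \<open>div F\<close> and the regular distribution of \<open>f\<close> on the whole space.\<close>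

definition weak_div ::
  "(real^'n::finite \<Rightarrow> complex^'n) \<Rightarrow> (real^'n \<Rightarrow> complex) \<Rightarrow> complex" where
  "weak_div F \<phi> = - (LINT x|lebesgue. cdot (F x) (grad \<phi> x))"

definition regular_distr ::
  "(real^'n::finite \<Rightarrow> complex) \<Rightarrow> (real^'n \<Rightarrow> complex) \<Rightarrow> complex" where
  "regular_distr f \<phi> = (LINT x|lebesgue. f x * \<phi> x)"


section \<open>The radiation condition\<close>

text \<open>Surface measure on the sphere of radius \<open>R\<close> about the origin, as in integration in polar
  coordinates: on the unit sphere, the measure of \<open>E\<close> is \<open>d\<close> times the volume of the cone
  \<open>{t x | x \<in> E, 0 < t < 1}\<close>, and scaling by \<open>R\<close> multiplies areas by \<open>R ^ (d - 1)\<close>.\<close>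

definition sphere_measure :: "real \<Rightarrow> (real^'n::finite) measure" where
  "sphere_measure R = scale_measure (ennreal (real CARD('n) * R ^ (CARD('n) - 1)))
     (distr (restrict_space lborel (ball 0 1)) borel (\<lambda>x. (R / norm x) *\<^sub>R x))"

definition radial_derivative :: "(real^'n::finite \<Rightarrow> complex) \<Rightarrow> real^'n \<Rightarrow> complex" where
  "radial_derivative u x = frechet_derivative u (at x) (x /\<^sub>R norm x)"

text \<open>Outside a large ball the scattered field solves the Helmholtz equation, hence has a smooth
  representative there; the condition refers to that representative. The Lebesgue integral of
  nonnegative functions avoids the value \<open>0\<close> that the Bochner integral gives to non-integrable
  functions.\<close>

definition radiation_condition :: "real \<Rightarrow> (real^'n::finite \<Rightarrow> complex) \<Rightarrow> bool" where
  "radiation_condition k u \<longleftrightarrow>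
     (\<exists>R\<^sub>0. Ck_on 1 {x. R\<^sub>0 < norm x} u) \<and>
     ((\<lambda>R. \<integral>\<^sup>+ x. ennreal ((cmod (radial_derivative u x - \<i> * complex_of_real k * u x))\<^sup>2)
         \<partial>sphere_measure R) \<longlongrightarrow> 0) at_top"


section \<open>Scattered fields and non-scattering frequencies\<close>

definition zero_ext :: "'a set \<Rightarrow> ('a \<Rightarrow> 'b::zero) \<Rightarrow> 'a \<Rightarrow> 'b" where
  "zero_ext D f x = (if x \<in> D then f x else 0)"

text \<open>\<open>D\<close> is the domain of the incident field \<open>u\<^sub>i\<close>. Where \<open>D\<close> contains the closure of the
  scatterer, the jumps of the zero extensions across its boundary are multiplied by zero.\<close>

definition scattered_field ::
  "(real^'n::finite \<Rightarrow> real^'n^'n) \<Rightarrow> (real^'n \<Rightarrow> real) \<Rightarrow> real \<Rightarrow> (real^'n) set \<Rightarrow>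
     (real^'n \<Rightarrow> complex) \<Rightarrow> (real^'n \<Rightarrow> complex) \<Rightarrow> bool" where
  "scattered_field A q k D u\<^sub>i u\<^sub>s \<longleftrightarrow>
     (\<forall>B. domain B \<and> bounded B \<longrightarrow> H1 B u\<^sub>s) \<and>
     (\<exists>g. weak_gradient UNIV u\<^sub>s g \<and>
        (\<forall>\<phi>. test_function UNIV \<phi> \<longrightarrow>
           weak_div (\<lambda>x. cmatrix (A x) *v g x) \<phi>
             + (complex_of_real k)\<^sup>2 * regular_distr (\<lambda>x. complex_of_real (q x) * u\<^sub>s x) \<phi>
           = - weak_div (\<lambda>x. cmatrix (A x - mat 1) *v zero_ext D (grad u\<^sub>i) x) \<phi>
             - (complex_of_real k)\<^sup>2
                 * regular_distr (\<lambda>x. complex_of_real (q x - 1) * zero_ext D u\<^sub>i x) \<phi>)) \<and>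
     radiation_condition k u\<^sub>s"

definition non_scattering_frequency ::
  "(real^'n::finite \<Rightarrow> real^'n^'n) \<Rightarrow> (real^'n \<Rightarrow> real) \<Rightarrow> (real^'n) set \<Rightarrow> real \<Rightarrow> bool" where
  "non_scattering_frequency A q \<Omega> k \<longleftrightarrow> 0 < k \<and>
     (\<exists>D u\<^sub>i u\<^sub>s. domain D \<and> closure \<Omega> \<subseteq> D \<and>
        helmholtz_solution k D u\<^sub>i \<and> (\<exists>x\<in>D. u\<^sub>i x \<noteq> 0) \<and>
        scattered_field A q k D u\<^sub>i u\<^sub>s \<and> (\<forall>x. x \<notin> \<Omega> \<longrightarrow> u\<^sub>s x = 0))"


section \<open>Block matrices\<close>

definition symmetric_positive_definite :: "real^'m::finite^'m \<Rightarrow> bool" where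
  "symmetric_positive_definite M \<longleftrightarrow> transpose M = M \<and> (\<forall>v. v \<noteq> 0 \<longrightarrow> 0 < v \<bullet> (M *v v))"

text \<open>The block diagonal matrix with blocks \<open>1\<close> and \<open>M\<close>. A bijection \<open>e\<close> splits the \<open>d\<close> coordinate
  indices into a first one, sent to \<open>None\<close>, and the \<open>d - 1\<close> indices of \<open>M\<close>.\<close>

definition block_one_diag ::
  "('n \<Rightarrow> 'm option) \<Rightarrow> real^'m::finite^'m \<Rightarrow> real^'n::finite^'n" where
  "block_one_diag e M = (\<chi> i j. case (e i, e j) of
       (None, None) \<Rightarrow> 1
     | (Some a, Some b) \<Rightarrow> M $ a $ b
     | _ \<Rightarrow> 0)"

end

(* The plane wave exp(i k x . v) with v = U e_1 is an incident field. Since v is an eigenvector of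
   A with eigenvalue 1 almost everywhere and the gradient of the wave is parallel to v, the source
   term div((A - Id) grad u_i) vanishes, so the scattered field u_s = 0 does the job. *)

theory Submission
  imports Defs
begin

definition plane_wave :: "real \<Rightarrow> real^'n::finite \<Rightarrow> real^'n \<Rightarrow> complex" where
  "plane_wave k v x = exp (\<i> * complex_of_real (k * (x \<bullet> v)))"

text \<open>The constant factor \<open>c\<close> keeps the family closed under differentiation: each
  partial derivative of a multiple of a plane wave is again such a multiple, so the rule can be
  iterated.\<close>

lemma has_derivative_plane_wave:
  "((\<lambda>x. c * plane_wave k v x) has_derivative
     (\<lambda>h. c * (\<i> * complex_of_real (k * (h \<bullet> v))) * plane_wave k v x)) (at x)"
proof -
  have "((\<lambda>x. \<i> * complex_of_real (k * (x \<bullet> v))) has_derivative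
      (\<lambda>h. \<i> * complex_of_real (k * (h \<bullet> v)))) (at x)"
    by (auto intro!: derivative_eq_intros)
  moreover have "(exp has_derivative (\<lambda>h. exp z * h)) (at z)" for z :: complex
    using DERIV_exp[of z] by (simp add: has_field_derivative_def)
  ultimately have "((\<lambda>x. exp (\<i> * complex_of_real (k * (x \<bullet> v)))) has_derivative
      (\<lambda>h. exp (\<i> * complex_of_real (k * (x \<bullet> v))) * (\<i> * complex_of_real (k * (h \<bullet> v)))))
      (at x)"
    by (rule has_derivative_compose)
  from has_derivative_mult_right[OF this, of c] show ?thesis
    by (simp add: plane_wave_def mult_ac)
qed

lemma partial_plane_wave:
  "partial i (\<lambda>x. c * plane_wave k v x)
     = (\<lambda>x. (c * (\<i> * complex_of_real (k * v $ i))) * plane_wave k v x)"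
proof
  fix x
  show "partial i (\<lambda>x. c * plane_wave k v x) x
      = (c * (\<i> * complex_of_real (k * v $ i))) * plane_wave k v x"
    unfolding partial_def frechet_derivative_at[OF has_derivative_plane_wave, symmetric]
    by (simp add: inner_axis')
qed

lemma grad_plane_wave:
  "grad (plane_wave k v) x
     = (\<i> * complex_of_real k * plane_wave k v x) *s (\<chi> i. complex_of_real (v $ i))"
  using partial_plane_wave[of _ 1 k v] by (simp add: grad_def vec_eq_iff)

text \<open>Differentiating only changes the constant in front, so the induction on \<open>m\<close>
  closes once \<open>c\<close> is generalised.\<close>

lemma Ck_on_plane_wave: "Ck_on m D (\<lambda>x. c * plane_wave k v x)"
proof (induction m arbitrary: c)
  case 0
  show ?case
    using has_derivative_continuous[OF has_derivative_plane_wave]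
    unfolding Ck_on.simps by (intro continuous_at_imp_continuous_on ballI)
next
  case (Suc m)
  have "(\<lambda>x. c * plane_wave k v x) differentiable at x" for x
    unfolding differentiable_def using has_derivative_plane_wave by blast
  with Suc show ?case
    by (simp add: partial_plane_wave)
qed

lemma helmholtz_solution_plane_wave:
  assumes "norm v = 1"
  shows "helmholtz_solution k D (plane_wave k v)"
  unfolding helmholtz_solution_def
proof (intro conjI ballI)
  show "Ck_on 2 D (plane_wave k v)"
    using Ck_on_plane_wave[of 2 D 1 k v] by simp
  fix x
  have "(\<Sum>i\<in>UNIV. (v $ i)\<^sup>2) = 1"
    using assms by (simp add: norm_vec_def L2_set_def)
  then have v: "(\<Sum>i\<in>UNIV. (complex_of_real (v $ i))\<^sup>2) = 1"
    unfolding of_real_power[symmetric] of_real_sum[symmetric] by simp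
  \<comment> \<open>Two derivatives in direction \<open>i\<close> bring out the square of
    \<open>\<i> * k * v $ i\<close>. Only the factor \<open>(v $ i)\<^sup>2\<close> depends on
    \<open>i\<close>, so the sum collapses to the squared norm of \<open>v\<close>, which is
    1.\<close>
  have "partial i (partial i (plane_wave k v)) x
      = (complex_of_real (v $ i))\<^sup>2 * (- (complex_of_real k)\<^sup>2 * plane_wave k v x)" for i
  proof -
    have "partial i (plane_wave k v)
        = (\<lambda>x. (1 * (\<i> * complex_of_real (k * v $ i))) * plane_wave k v x)"
      using partial_plane_wave[of i 1 k v] by simp
    then show ?thesis
      by (simp only: partial_plane_wave) (simp add: power2_eq_square algebra_simps)
  qed
  then have "(\<Sum>i\<in>UNIV. partial i (partial i (plane_wave k v)) x)
      = (\<Sum>i\<in>UNIV. (complex_of_real (v $ i))\<^sup>2) * (- (complex_of_real k)\<^sup>2 * plane_wave k v x)"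
    by (simp only: sum_distrib_right)
  then show "(\<Sum>i\<in>UNIV. partial i (partial i (plane_wave k v)) x)
      + (complex_of_real k)\<^sup>2 * plane_wave k v x = 0"
    by (simp add: v)
qed

lemma cmatrix_mult_of_real:
  "cmatrix M *v (\<chi> i. complex_of_real (v $ i)) = (\<chi> i. complex_of_real ((M *v v) $ i))"
  by (simp add: cmatrix_def matrix_vector_mult_def vec_eq_iff)

text \<open>The gradient is a complex multiple of the real vector \<open>v\<close>, and
  \<open>M - mat 1\<close> annihilates \<open>v\<close>.\<close>

lemma cmatrix_mult_grad_plane_wave:
  assumes "M *v v = v"
  shows "cmatrix (M - mat 1) *v grad (plane_wave k v) x = 0"
proof -
  have "(M - mat 1) *v v = 0"
    using assms by (simp add: matrix_vector_mult_diff_rdistrib)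
  then show ?thesis
    by (simp add: grad_plane_wave vector_scalar_commute cmatrix_mult_of_real vec_eq_iff)
qed

text \<open>By injectivity \<open>i\<close> is the only index sent to \<open>None\<close>, so column
  \<open>i\<close> of the block matrix has 1 on the diagonal and 0 elsewhere.\<close>

lemma block_one_diag_axis:
  assumes "inj e" and "e i = None"
  shows "block_one_diag e M *v axis i 1 = axis i 1"
proof -
  have "(block_one_diag e M *v axis i 1) $ j = axis i 1 $ j" for j
  proof (cases "e j")
    case None
    then have "j = i"
      using assms by (metis injD)
    then show ?thesis
      using assms(2) by (simp add: matrix_vector_mult_basis column_def block_one_diag_def)
  next
    case (Some a)
    then have "j \<noteq> i"
      using assms(2) by auto
    then show ?thesis
      using Some assms(2)
      \<comment> \<open>\<open>axis_def\<close> has to wait for the second call, since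
        \<open>matrix_vector_mult_basis\<close> matches on a folded \<open>axis\<close>.\<close>
      by (simp add: matrix_vector_mult_basis column_def block_one_diag_def) (simp add: axis_def)
  qed
  then show ?thesis
    by (simp add: vec_eq_iff)
qed

lemma partial_const [simp]: "partial i (\<lambda>x. c) = (\<lambda>x. 0)"
  by (rule ext) (simp add: partial_def)

lemma weak_gradient_zero: "weak_gradient D (\<lambda>x. 0) (\<lambda>x. 0)"
  by (simp add: weak_gradient_def locally_integrable_def)

lemma H1_zero: "H1 D (\<lambda>x. 0)"
  using weak_gradient_zero[of D] by (auto simp: H1_def L2_def intro!: exI[of _ "\<lambda>x. 0"])

lemma radiation_condition_zero: "radiation_condition k (\<lambda>x. 0)"
  by (auto simp: radiation_condition_def radial_derivative_def)

text \<open>With \<open>q = 1\<close> the zeroth-order source vanishes, leaving only the divergence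
  source. Both sides of the equation are tested by integrals, so vanishing almost everywhere is
  enough.\<close>

lemma scattered_field_zero:
  assumes "AE x in lebesgue. cmatrix (A x - mat 1) *v zero_ext D (grad u) x = 0"
  shows "scattered_field A (\<lambda>_. 1) k D u (\<lambda>x. 0)"
proof -
  have "weak_div (\<lambda>x. cmatrix (A x - mat 1) *v zero_ext D (grad u) x) \<phi> = 0" for \<phi>
    using assms unfolding weak_div_def neg_equal_0_iff_equal
    by (intro integral_eq_zero_AE) (auto simp: cdot_def)
  moreover have "weak_div (\<lambda>x. cmatrix (A x) *v 0) \<phi> = 0" for \<phi>
    by (simp add: weak_div_def cdot_def)
  ultimately show ?thesis
    using weak_gradient_zero[of UNIV]
    by (auto simp: scattered_field_def H1_zero radiation_condition_zero regular_distr_def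
        intro!: exI[of _ "\<lambda>x. 0"])
qed

theorem mainTheorem7:
  fixes \<Omega> :: "(real^'n::finite) set"
    and A :: "real^'n \<Rightarrow> real^'n^'n"
    and A' :: "real^'n \<Rightarrow> real^'m::finite^'m"
    and U :: "real^'n^'n"
    and e :: "'n \<Rightarrow> 'm option"
    and k :: real
  assumes "CARD('n) \<ge> 2"
    and "bounded_lipschitz_domain \<Omega>"
    and "connected (- closure \<Omega>)"
    and "coefficient_assumptions A (\<lambda>_. 1) \<Omega>"
    and "bij e"
    and "orthogonal_matrix U"
    and "AE x in lebesgue_on (closure \<Omega>). symmetric_positive_definite (A' x) \<and>
           A x = U ** block_one_diag e (A' x) ** transpose U"
    and "k > 0"
  shows "non_scattering_frequency A (\<lambda>_. 1) \<Omega> k"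
proof -
  \<comment> \<open>Surjectivity of \<open>e\<close> supplies the index of the scalar block;
    \<open>U\<close> maps its basis vector to the direction of propagation.\<close>
  obtain i where i: "e i = None"
    using \<open>bij e\<close> by (metis bij_pointE)
  define v where "v = U *v axis i 1"
  have "orthogonal_transformation ((*v) U)"
    using \<open>orthogonal_matrix U\<close> by (simp add: orthogonal_transformation_matrix)
  then have "norm v = 1"
    by (simp add: v_def orthogonal_transformation_norm)
  have "transpose U *v v = axis i 1"
    using \<open>orthogonal_matrix U\<close>
    by (simp add: v_def orthogonal_matrix_def matrix_vector_mul_assoc)
  then have eigenvector: "(U ** block_one_diag e M ** transpose U) *v v = v" for M
    using block_one_diag_axis[OF bij_is_inj[OF \<open>bij e\<close>] i, of M]
    by (simp add: v_def flip: matrix_vector_mul_assoc)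
  have "AE x in lebesgue_on (closure \<Omega>). A x *v v = v"
    using assms(7) by eventually_elim (simp add: eigenvector)
  then have "AE x in lebesgue. x \<in> closure \<Omega> \<longrightarrow> A x *v v = v"
    by (simp add: AE_restrict_space_iff)
  \<comment> \<open>Off \<open>closure \<Omega>\<close> the matrix \<open>A x\<close> is the
    identity, which also fixes \<open>v\<close>, so the identity extends to the whole space.\<close>
  then have "AE x in lebesgue. A x *v v = v"
    by eventually_elim (use assms(4) in \<open>auto simp: coefficient_assumptions_def\<close>)
  \<comment> \<open>A plane wave is entire, so the domain of the incident field can be
    \<open>UNIV\<close>, where zero extension changes nothing.\<close>
  then have "AE x in lebesgue. cmatrix (A x - mat 1) *v zero_ext UNIV (grad (plane_wave k v)) x = 0"
    by eventually_elim (simp add: zero_ext_def cmatrix_mult_grad_plane_wave)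
  then have "scattered_field A (\<lambda>_. 1) k UNIV (plane_wave k v) (\<lambda>x. 0)"
    by (rule scattered_field_zero)
  moreover have "domain (UNIV :: (real^'n) set)"
    by (simp add: domain_def connected_UNIV)
  moreover have "\<exists>x\<in>UNIV. plane_wave k v x \<noteq> 0"
    by (simp add: plane_wave_def)
  ultimately show ?thesis
    using \<open>k > 0\<close> helmholtz_solution_plane_wave[OF \<open>norm v = 1\<close>]
    unfolding non_scattering_frequency_def by blast
qed

end
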